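(* Let $K\subset L$ be a field extension and put $T=K+XL[X]$. Then $T$ is Noetherian if and only if $[L\colon K]<\infty$.
   Context: Rings are commutative with unity. $K+XL[X]$ denotes the polynomial composite, i.e. the subring of $L[X]$ consisting of the polynomials whose constant term lies in $K$. $[L\colon K]$ is the degree of the extension $K\subset L$. *)

theory Defs
  imports "HOL-Algebra.Polynomial_Divisibility" "HOL-Algebra.Embedded_Algebras"
begin

text \<open>
  \<^term>\<open>K\<close> is a subset of \<^term>\<open>carrier L\<close>. Polynomials over \<^term>\<open>L\<close> are lists with the
  leading coefficient first, so the constant term is read off with \<^term>\<open>ring.coeff L p 0\<close>
  (which is zero for the zero polynomial).
\<close>
definition polynomial_composite :: "('a, 'b) ring_scheme \<Rightarrow> 'a set \<Rightarrow> 'a list ring"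
  where "polynomial_composite L K =
    (poly_ring L) \<lparr> carrier := { p \<in> carrier (poly_ring L). ring.coeff L p 0 \<in> K } \<rparr>"

lemma polynomial_composite_subcring:
  assumes "field L" and "subfield K L"
  shows "subcring (carrier (polynomial_composite L K)) (poly_ring L)"
proof -
  interpret L: field L by fact
  interpret P: domain "poly_ring L" using L.univ_poly_is_domain[OF L.carrier_is_subring] .
  have K: "subring K L" using assms(2) subfieldE(1) by blast
  have in_L: "set p \<subseteq> carrier L" if "p \<in> carrier (poly_ring L)" for p
    using that L.polynomial_incl unfolding univ_poly_carrier[symmetric] by blast
  have add: "L.coeff (p \<oplus>\<^bsub>poly_ring L\<^esub> q) 0 = L.coeff p 0 \<oplus>\<^bsub>L\<^esub> L.coeff q 0"
    if "p \<in> carrier (poly_ring L)" "q \<in> carrier (poly_ring L)" for p q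
    using L.poly_add_coeff[OF in_L[OF that(1)] in_L[OF that(2)]] by (simp add: univ_poly_add)
  have mult: "L.coeff (p \<otimes>\<^bsub>poly_ring L\<^esub> q) 0 = L.coeff p 0 \<otimes>\<^bsub>L\<^esub> L.coeff q 0"
    if "p \<in> carrier (poly_ring L)" "q \<in> carrier (poly_ring L)" for p q
    using L.poly_mult_coeff[OF in_L[OF that(1)] in_L[OF that(2)]] in_L[OF that(1)] in_L[OF that(2)]
    by (simp add: univ_poly_mult)
  have uminus: "L.coeff (\<ominus>\<^bsub>poly_ring L\<^esub> p) 0 = \<ominus>\<^bsub>L\<^esub> L.coeff p 0"
    if p: "p \<in> carrier (poly_ring L)" for p
  proof -
    have "L.coeff (\<ominus>\<^bsub>poly_ring L\<^esub> p) 0 \<oplus>\<^bsub>L\<^esub> L.coeff p 0 = \<zero>\<^bsub>L\<^esub>"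
      using add[OF P.a_inv_closed[OF p] p] P.l_neg[OF p] by (simp add: univ_poly_zero)
    then show ?thesis
      using L.coeff_in_carrier in_L[OF p] in_L[OF P.a_inv_closed[OF p]] L.minus_equality by metis
  qed
  have one: "L.coeff \<one>\<^bsub>poly_ring L\<^esub> 0 = \<one>\<^bsub>L\<^esub>" by (simp add: univ_poly_one)
  have "subring (carrier (polynomial_composite L K)) (poly_ring L)"
  proof (rule P.subringI)
    show "carrier (polynomial_composite L K) \<subseteq> carrier (poly_ring L)"
      by (auto simp: polynomial_composite_def)
  qed (use subringE[OF K] in \<open>simp_all add: polynomial_composite_def add mult uminus one\<close>)
  then show ?thesis
    using P.subcring_iff P.subcringI' by blast
qed

end

theory Submission
  imports Defs
begin

text \<open>
  Write \<open>P = L[X]\<close> and \<open>T = K + XL[X]\<close>. Both implications compare an ideal of \<open>T\<close> with a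
  \<open>K\<close>-subspace of \<open>L\<close> that records one coefficient.

  Suppose that \<open>T\<close> is Noetherian. The ideal \<open>I = XP\<close> of \<open>T\<close> is then generated by a finite set.
  If \<open>t \<in> T\<close> and \<open>p \<in> I\<close>, the linear coefficient of \<open>tp\<close> is the constant term of \<open>t\<close>, which lies in
  \<open>K\<close>, times the linear coefficient of \<open>p\<close>. Hence the linear coefficients of the generators span
  the linear coefficients of all elements of \<open>I\<close> over \<open>K\<close>, and these fill \<open>L\<close>.

  Suppose that \<open>L\<close> is finite-dimensional over \<open>K\<close>, and let \<open>I\<close> be an ideal of \<open>T\<close>. The polynomials
  \<open>p\<close> with \<open>XPp \<subseteq> I\<close> form an ideal of the principal ideal domain \<open>P\<close>, say \<open>fP\<close>, and so
  \<open>XfP \<subseteq> I \<subseteq> fP\<close> (lemma \<open>T_ideal_between\<close>). An element \<open>fg\<close> of \<open>I\<close> is determined modulo \<open>XfP\<close> by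
  the constant term of \<open>g\<close>. The constant terms that occur form a \<open>K\<close>-subspace of \<open>L\<close>, which is
  finite-dimensional, so finitely many elements of \<open>I\<close> generate \<open>I\<close> modulo \<open>XfP\<close>
  (\<open>finite_cofactor_witnesses\<close> and \<open>mult_mem_if_cofactor_const\<close>). The same argument with \<open>Xf\<close> in place
  of \<open>f\<close> shows that finitely many elements generate \<open>XfP\<close> modulo \<open>X(Xf)P\<close>, and the latter lies
  in the ideal of \<open>T\<close> generated by \<open>Xf\<close> because \<open>XP \<subseteq> T\<close>.
\<close>

section \<open>Ideals and subspaces by closure conditions\<close>

text \<open>
  In a commutative ring with unity, negation is multiplication by \<open>-1\<close>. Avoiding it here matters
  below: the additive inverse of a subring is defined through its own carrier, whereas sums and
  products agree by definition with those of the larger ring.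
\<close>
lemma (in cring) ideal_iff:
  "ideal I R \<longleftrightarrow> I \<subseteq> carrier R \<and> \<zero> \<in> I \<and> (\<forall>a\<in>I. \<forall>b\<in>I. a \<oplus> b \<in> I) \<and> (\<forall>x\<in>carrier R. \<forall>a\<in>I. x \<otimes> a \<in> I)"
    (is "_ \<longleftrightarrow> ?rhs")
proof
  assume "ideal I R"
  then interpret ideal I R .
  show ?rhs using a_subset zero_closed a_closed I_l_closed by blast
next
  assume I: ?rhs
  have "\<ominus> a \<in> I" if "a \<in> I" for a
  proof -
    have "\<ominus> \<one> \<otimes> a \<in> I" "a \<in> carrier R" using I that by auto
    then show ?thesis by (simp add: l_minus)
  qed
  then have "subgroup I (add_monoid R)"
    using I by (intro add.subgroupI) auto
  then show "ideal I R"
    by (rule idealI[OF ring_axioms]) (use I m_comm in \<open>metis subsetD\<close>)+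
qed

lemma (in ring) subalgebraI:
  assumes "subfield K R" and V: "V \<subseteq> carrier R" "\<zero> \<in> V"
    and add: "\<And>u v. u \<in> V \<Longrightarrow> v \<in> V \<Longrightarrow> u \<oplus> v \<in> V"
    and smult: "\<And>k v. k \<in> K \<Longrightarrow> v \<in> V \<Longrightarrow> k \<otimes> v \<in> V"
  shows "subalgebra K V R"
proof -
  have "\<ominus> \<one> \<in> K"
    using subringE(3,5)[OF subfieldE(1)[OF assms(1)]] by blast
  then have "\<ominus> v \<in> V" if "v \<in> V" for v
    using smult[of "\<ominus> \<one>" v] that V by (auto simp: l_minus subset_iff)
  then have "subgroup V (add_monoid R)"
    using V add by (intro add.subgroupI) auto
  then show ?thesis
    by (simp add: smult subalgebra.intro subalgebra_axioms.intro)
qed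

section \<open>The polynomial composite and low-order coefficients\<close>

locale field_composite = field L for L :: "('a, 'b) ring_scheme" (structure) +
  fixes K :: "'a set"
  assumes subfield: "subfield K L"
begin

abbreviation P :: "'a list ring" where "P \<equiv> poly_ring L"
abbreviation T :: "'a list ring" where "T \<equiv> polynomial_composite L K"

sublocale P: principal_domain P
  using univ_poly_is_principal[OF carrier_is_subfield] .

lemma T_mult [simp]: "p \<otimes>\<^bsub>T\<^esub> q = p \<otimes>\<^bsub>P\<^esub> q"
  and T_add [simp]: "p \<oplus>\<^bsub>T\<^esub> q = p \<oplus>\<^bsub>P\<^esub> q"
  and T_zero [simp]: "\<zero>\<^bsub>T\<^esub> = \<zero>\<^bsub>P\<^esub>"
  and T_carrier: "p \<in> carrier T \<longleftrightarrow> p \<in> carrier P \<and> coeff p 0 \<in> K"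
  by (simp_all add: polynomial_composite_def)

sublocale T: cring T
proof -
  have "T = P\<lparr>carrier := carrier T\<rparr>"
    by (simp add: polynomial_composite_def)
  then show "cring T"
    using P.subcring_iff[of "carrier T"] polynomial_composite_subcring[OF field_axioms subfield]
    by (metis subcringE(1))
qed

lemma K_subset: "K \<subseteq> carrier L" and K_zero: "\<zero> \<in> K"
  using subringE(1,2)[OF subfieldE(1)[OF subfield]] by auto

lemma P_set: "p \<in> carrier P \<Longrightarrow> set p \<subseteq> carrier L"
  using polynomial_incl unfolding univ_poly_carrier[symmetric] by blast

lemma coeff_closed [simp]: "p \<in> carrier P \<Longrightarrow> coeff p i \<in> carrier L"
  using coeff_in_carrier P_set by blast

lemma coeff_add:
  "p \<in> carrier P \<Longrightarrow> q \<in> carrier P \<Longrightarrow> coeff (p \<oplus>\<^bsub>P\<^esub> q) i = coeff p i \<oplus> coeff q i"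
  by (simp add: univ_poly_add poly_add_coeff P_set del: poly_add.simps)

lemma coeff_mult_0:
  "p \<in> carrier P \<Longrightarrow> q \<in> carrier P \<Longrightarrow> coeff (p \<otimes>\<^bsub>P\<^esub> q) 0 = coeff p 0 \<otimes> coeff q 0"
  by (simp add: univ_poly_mult poly_mult_coeff P_set del: poly_mult.simps)

lemma coeff_mult_1:
  "p \<in> carrier P \<Longrightarrow> q \<in> carrier P \<Longrightarrow>
    coeff (p \<otimes>\<^bsub>P\<^esub> q) 1 = (coeff p 0 \<otimes> coeff q 1) \<oplus> (coeff p 1 \<otimes> coeff q 0)"
  by (simp add: univ_poly_mult poly_mult_coeff P_set atMost_Suc a_comm del: poly_mult.simps)

lemma coeff_uminus:
  assumes p: "p \<in> carrier P" shows "coeff (\<ominus>\<^bsub>P\<^esub> p) i = \<ominus> coeff p i"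
proof -
  have "coeff (\<ominus>\<^bsub>P\<^esub> p) i \<oplus> coeff p i = \<zero>"
    using coeff_add[OF P.a_inv_closed[OF p] p, of i] P.l_neg[OF p] by (simp add: univ_poly_zero)
  then show ?thesis
    using minus_equality p by simp
qed

lemma var_P [simp]: "X \<in> carrier P"
  using var_closed(1)[OF carrier_is_subring] .

lemma coeff_X_mult:
  assumes "q \<in> carrier P"
  shows "coeff (X \<otimes>\<^bsub>P\<^esub> q) 0 = \<zero>" "coeff (X \<otimes>\<^bsub>P\<^esub> q) 1 = coeff q 0"
proof -
  have "coeff X 0 = \<zero>" "coeff X 1 = \<one>" by (auto simp: var_def)
  then show "coeff (X \<otimes>\<^bsub>P\<^esub> q) 0 = \<zero>" "coeff (X \<otimes>\<^bsub>P\<^esub> q) 1 = coeff q 0"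
    using assms coeff_mult_0[OF var_P assms] coeff_mult_1[OF var_P assms] by auto
qed

text \<open>
  Multiples of \<open>X\<close> with arbitrary cofactor in \<open>L[X]\<close> lie in \<open>T\<close>; this is how ideals of \<open>T\<close> come
  close to being ideals of \<open>L[X]\<close>.
\<close>
lemma X_mult_T [simp]: "q \<in> carrier P \<Longrightarrow> X \<otimes>\<^bsub>P\<^esub> q \<in> carrier T"
  by (simp add: T_carrier coeff_X_mult K_zero)

lemma X_dividesE:
  assumes p: "p \<in> carrier P" and "coeff p 0 = \<zero>"
  obtains q where "q \<in> carrier P" "p = X \<otimes>\<^bsub>P\<^esub> q"
proof (cases "p = []")
  case True
  then show ?thesis
    using that[OF P.zero_closed] P.r_null[OF var_P] by (simp add: univ_poly_zero)
next
  case False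
  define q where "q = butlast p"
  have "last p = \<zero>"
    using assms(2) False by (simp add: coeff_nth last_conv_nth)
  then have p_eq: "p = q @ [\<zero>]"
    using False append_butlast_last_id unfolding q_def by metis
  have "polynomial (carrier L) p"
    using p by (simp add: univ_poly_carrier)
  then have q: "polynomial (carrier L) q" "q \<noteq> []"
    unfolding p_eq by (auto simp: polynomial_def hd_append split: if_splits)
  then have "q \<in> carrier P"
    by (simp add: univ_poly_carrier)
  moreover have "p = X \<otimes>\<^bsub>P\<^esub> q"
    using poly_mult_var[OF carrier_is_subring \<open>q \<in> carrier P\<close>] q p_eq P.m_comm[OF var_P \<open>q \<in> carrier P\<close>] by simp
  ultimately show ?thesis using that by blast
qed

lemma const_P:
  assumes "c \<in> carrier L"
  shows "poly_of_const c \<in> carrier P" "coeff (poly_of_const c) 0 = c"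
  using assms by (auto simp: poly_of_const_def univ_poly_carrier[symmetric] polynomial_def)

lemma T_subset: "p \<in> carrier T \<Longrightarrow> p \<in> carrier P"
  by (simp add: T_carrier)

lemma T_ideal_iff:
  "ideal I T \<longleftrightarrow> I \<subseteq> carrier T \<and> \<zero>\<^bsub>P\<^esub> \<in> I \<and> (\<forall>p\<in>I. \<forall>q\<in>I. p \<oplus>\<^bsub>P\<^esub> q \<in> I) \<and>
    (\<forall>t\<in>carrier T. \<forall>p\<in>I. t \<otimes>\<^bsub>P\<^esub> p \<in> I)"
  using T.ideal_iff by simp

section \<open>Noetherian composites have finite degree\<close>

text \<open>The ideal \<open>XL[X]\<close> is finitely generated over \<open>T\<close> only if \<open>L\<close> is finitely spanned over \<open>K\<close>.\<close>
lemma finite_dimension_if_noetherian: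
  assumes "noetherian_ring T"
  shows "finite_dimension K (carrier L)"
proof -
  interpret T: noetherian_ring T by fact
  have subring: "subring K L" using subfieldE(1)[OF subfield] .
  define I where "I = {p \<in> carrier T. coeff p 0 = \<zero>}"
  have "ideal I T"
    unfolding T_ideal_iff
  proof (intro conjI ballI)
    show "\<zero>\<^bsub>P\<^esub> \<in> I"
      using T.zero_closed by (simp add: I_def univ_poly_zero)
    show "p \<oplus>\<^bsub>P\<^esub> q \<in> I" if "p \<in> I" "q \<in> I" for p q
      using that K_zero by (auto simp: I_def T_carrier coeff_add)
    show "t \<otimes>\<^bsub>P\<^esub> p \<in> I" if "t \<in> carrier T" "p \<in> I" for t p
      using that K_zero by (auto simp: I_def T_carrier coeff_mult_0)
  qed (simp add: I_def)
  then obtain A where A: "A \<subseteq> carrier T" "finite A" "I = Idl\<^bsub>T\<^esub> A"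
    using T.finetely_gen by blast
  obtain As where As: "set As = A"
    using finite_list[OF A(2)] by blast
  have As_P: "set As \<subseteq> carrier P"
    using A(1) As T_subset by auto
  define cs where "cs = map (\<lambda>a. coeff a 1) As"
  have cs: "set cs \<subseteq> carrier L"
    using As_P by (auto simp: cs_def)
  note span = Span_subgroup_props[OF subfield cs] Span_smult_closed[OF subfield cs]
  \<comment> \<open>Induction over the generated ideal: the elements with linear coefficient in the span form an
     ideal of \<open>T\<close> that contains the generators.\<close>
  define J where "J = {p \<in> I. coeff p 1 \<in> Span K cs}"
  have "ideal J T"
    unfolding T_ideal_iff
  proof (intro conjI ballI)
    note I = \<open>ideal I T\<close>[unfolded T_ideal_iff]
    have I_P: "p \<in> carrier P" if "p \<in> I" for p
      using that by (simp add: I_def T_carrier)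
    show "J \<subseteq> carrier T" by (auto simp: J_def I_def)
    show "\<zero>\<^bsub>P\<^esub> \<in> J"
      using I span(2) by (simp add: J_def univ_poly_zero del: Span.simps)
    show "p \<oplus>\<^bsub>P\<^esub> q \<in> J" if "p \<in> J" "q \<in> J" for p q
      using that I span(3) by (simp add: J_def coeff_add I_P del: Span.simps)
    show "t \<otimes>\<^bsub>P\<^esub> p \<in> J" if t: "t \<in> carrier T" and p: "p \<in> J" for t p
    proof -
      have tp: "t \<in> carrier P" "coeff t 0 \<in> K" "p \<in> carrier P" "coeff p 0 = \<zero>" "coeff p 1 \<in> Span K cs"
        using t p by (auto simp: T_carrier J_def I_def)
      have "coeff (t \<otimes>\<^bsub>P\<^esub> p) 1 = coeff t 0 \<otimes> coeff p 1"
        unfolding coeff_mult_1[OF tp(1,3)] tp(4) using tp(1,3) by simp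
      then show ?thesis
        using t p I span(5)[OF tp(2,5)] by (simp add: J_def del: Span.simps)
    qed
  qed
  moreover have "A \<subseteq> J"
    using T.genideal_self[OF A(1)] A(3) As Span_base_incl[OF subfield cs]
    by (auto simp: J_def cs_def simp del: Span.simps)
  ultimately have "I \<subseteq> J"
    using T.genideal_minimal A(3) by blast
  have "c \<in> Span K cs" if "c \<in> carrier L" for c
  proof -
    define p where "p = X \<otimes>\<^bsub>P\<^esub> poly_of_const c"
    have "p \<in> I" "coeff p 1 = c"
      using const_P[OF that] unfolding p_def I_def
      by (simp_all add: coeff_X_mult[simplified])
    then show ?thesis using \<open>I \<subseteq> J\<close> by (auto simp: J_def simp del: Span.simps)
  qed
  then have "Span K cs = carrier L"
    using span(1) by blast
  then show ?thesis
    using Span_finite_dimension[OF subfield cs] by metis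
qed

section \<open>Finite degree implies Noetherian\<close>

text \<open>
  If \<open>XfP \<subseteq> N \<subseteq> fP\<close> and \<open>f \<noteq> 0\<close>, this is the image of \<open>N/XfP\<close> under the isomorphism
  \<open>fP/XfP \<cong> L\<close> that sends the class of \<open>fg\<close> to the constant term of \<open>g\<close>.
\<close>
definition cofactor_consts :: "'a list set \<Rightarrow> 'a list \<Rightarrow> 'a set"
  where "cofactor_consts N f = {coeff g 0 | g. g \<in> carrier P \<and> f \<otimes>\<^bsub>P\<^esub> g \<in> N}"

lemma subalgebra_cofactor_consts:
  assumes "ideal N T" and f: "f \<in> carrier P"
  shows "subalgebra K (cofactor_consts N f) L"
proof (rule subalgebraI[OF subfield])
  note N = assms(1)[unfolded T_ideal_iff]
  show "cofactor_consts N f \<subseteq> carrier L"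
    by (auto simp: cofactor_consts_def)
  show "\<zero> \<in> cofactor_consts N f"
    unfolding cofactor_consts_def
    using N f P.zero_closed P.r_null[OF f]
    by (intro CollectI exI[of _ "\<zero>\<^bsub>P\<^esub>"]) (simp add: univ_poly_zero)
  show "u \<oplus> v \<in> cofactor_consts N f" if uv: "u \<in> cofactor_consts N f" "v \<in> cofactor_consts N f" for u v
  proof -
    obtain g h where g: "g \<in> carrier P" "f \<otimes>\<^bsub>P\<^esub> g \<in> N" "u = coeff g 0"
      and h: "h \<in> carrier P" "f \<otimes>\<^bsub>P\<^esub> h \<in> N" "v = coeff h 0"
      using uv unfolding cofactor_consts_def by blast
    have "f \<otimes>\<^bsub>P\<^esub> (g \<oplus>\<^bsub>P\<^esub> h) \<in> N"
      using N f g h by (simp add: P.r_distr)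
    then show ?thesis
      unfolding cofactor_consts_def using g h coeff_add[of g h 0, symmetric] by auto
  qed
  show "k \<otimes> v \<in> cofactor_consts N f" if k: "k \<in> K" and v: "v \<in> cofactor_consts N f" for k v
  proof -
    obtain g where g: "g \<in> carrier P" "f \<otimes>\<^bsub>P\<^esub> g \<in> N" "v = coeff g 0"
      using v unfolding cofactor_consts_def by blast
    define t where "t = poly_of_const k"
    have t: "t \<in> carrier P" "coeff t 0 = k" "t \<in> carrier T"
      using const_P[of k] k K_subset by (auto simp: t_def T_carrier)
    have "f \<otimes>\<^bsub>P\<^esub> (t \<otimes>\<^bsub>P\<^esub> g) = t \<otimes>\<^bsub>P\<^esub> (f \<otimes>\<^bsub>P\<^esub> g)"
      using f g t by (simp add: P.m_lcomm)
    then have "f \<otimes>\<^bsub>P\<^esub> (t \<otimes>\<^bsub>P\<^esub> g) \<in> N"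
      using N g t by simp
    then show ?thesis
      unfolding cofactor_consts_def using g t coeff_mult_0[of t g, symmetric] by auto
  qed
qed

text \<open>
  Finitely many elements of \<open>I\<close> detect all of its cofactor constants: it suffices to realize a
  spanning list of that subspace, since the cofactor constants of any ideal \<open>N\<close> containing these
  elements form a \<open>K\<close>-subspace again.
\<close>
lemma finite_cofactor_witnesses:
  assumes fin: "finite_dimension K (carrier L)" and I: "ideal I T" and f: "f \<in> carrier P"
  obtains A where "finite A" "A \<subseteq> I"
    "\<And>N. ideal N T \<Longrightarrow> A \<subseteq> N \<Longrightarrow> cofactor_consts I f \<subseteq> cofactor_consts N f"
proof -
  have V: "subalgebra K (cofactor_consts I f) L"
    using subalgebra_cofactor_consts[OF I f] .
  then have "finite_dimension K (cofactor_consts I f)"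
    using subalbegra_incl_imp_finite_dimension[OF subfield fin] subalgebra_in_carrier by blast
  then obtain cs where cs: "set cs \<subseteq> carrier L" "Span K cs = cofactor_consts I f"
    using exists_base[OF subfield] by blast
  then have "\<forall>c\<in>set cs. \<exists>g. g \<in> carrier P \<and> f \<otimes>\<^bsub>P\<^esub> g \<in> I \<and> c = coeff g 0"
    using Span_base_incl[OF subfield cs(1)] unfolding cofactor_consts_def by blast
  then obtain g where g: "\<And>c. c \<in> set cs \<Longrightarrow> g c \<in> carrier P \<and> f \<otimes>\<^bsub>P\<^esub> g c \<in> I \<and> c = coeff (g c) 0"
    by metis
  show thesis
  proof (rule that)
    show "finite ((\<lambda>c. f \<otimes>\<^bsub>P\<^esub> g c) ` set cs)" "(\<lambda>c. f \<otimes>\<^bsub>P\<^esub> g c) ` set cs \<subseteq> I"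
      using g by auto
    fix N assume N: "ideal N T" and sub: "(\<lambda>c. f \<otimes>\<^bsub>P\<^esub> g c) ` set cs \<subseteq> N"
    have "set cs \<subseteq> cofactor_consts N f"
      using g sub unfolding cofactor_consts_def by blast
    then show "cofactor_consts I f \<subseteq> cofactor_consts N f"
      using subalgebra_Span_incl[OF subfield subalgebra_cofactor_consts[OF N f]] cs(2) by metis
  qed
qed

text \<open>
  Two multiples of \<open>f\<close> whose cofactors have the same constant term differ by a multiple of \<open>Xf\<close>. So
  an ideal that contains \<open>XfP\<close> can be recognized on multiples of \<open>f\<close> from its cofactor constants.
\<close>
lemma mult_mem_if_cofactor_const:
  assumes "ideal N T" and f: "f \<in> carrier P"
    and Xf: "\<And>h. h \<in> carrier P \<Longrightarrow> (X \<otimes>\<^bsub>P\<^esub> f) \<otimes>\<^bsub>P\<^esub> h \<in> N"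
    and g: "g \<in> carrier P" "coeff g 0 \<in> cofactor_consts N f"
  shows "f \<otimes>\<^bsub>P\<^esub> g \<in> N"
proof -
  obtain g' where g': "g' \<in> carrier P" "f \<otimes>\<^bsub>P\<^esub> g' \<in> N" "coeff g 0 = coeff g' 0"
    using g(2) unfolding cofactor_consts_def by blast
  have "coeff (g \<ominus>\<^bsub>P\<^esub> g') 0 = \<zero>"
    using g g' by (simp add: a_minus_def coeff_add coeff_uminus r_neg)
  then obtain h where h: "h \<in> carrier P" "g \<ominus>\<^bsub>P\<^esub> g' = X \<otimes>\<^bsub>P\<^esub> h"
    using X_dividesE[of "g \<ominus>\<^bsub>P\<^esub> g'"] g g' by auto
  have "g = g' \<oplus>\<^bsub>P\<^esub> (g \<ominus>\<^bsub>P\<^esub> g')"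
    using g(1) g'(1) by algebra
  then have "f \<otimes>\<^bsub>P\<^esub> g = f \<otimes>\<^bsub>P\<^esub> (g' \<oplus>\<^bsub>P\<^esub> X \<otimes>\<^bsub>P\<^esub> h)"
    using h(2) by simp
  also have "\<dots> = f \<otimes>\<^bsub>P\<^esub> g' \<oplus>\<^bsub>P\<^esub> (X \<otimes>\<^bsub>P\<^esub> f) \<otimes>\<^bsub>P\<^esub> h"
    using f g'(1) h(1) var_P by algebra
  finally show ?thesis
    using assms(1) g'(2) Xf[OF h(1)] unfolding T_ideal_iff by simp
qed

text \<open>
  Every ideal of \<open>T\<close> is squeezed between \<open>XfP\<close> and \<open>fP\<close>. The generator \<open>f\<close> comes from the largest
  ideal \<open>M\<close> of \<open>P\<close> with \<open>XM \<subseteq> I\<close>; it contains \<open>I\<close> because \<open>XP \<subseteq> T\<close>.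
\<close>
lemma T_ideal_between:
  assumes "ideal I T"
  obtains f where "f \<in> carrier P"
    "\<And>h. h \<in> carrier P \<Longrightarrow> (X \<otimes>\<^bsub>P\<^esub> f) \<otimes>\<^bsub>P\<^esub> h \<in> I"
    "\<And>p. p \<in> I \<Longrightarrow> \<exists>g\<in>carrier P. p = f \<otimes>\<^bsub>P\<^esub> g"
proof -
  note I = assms[unfolded T_ideal_iff]
  have I_P: "p \<in> carrier P" if "p \<in> I" for p
    using that I T_subset by blast
  define M where "M = {p \<in> carrier P. \<forall>h\<in>carrier P. (X \<otimes>\<^bsub>P\<^esub> h) \<otimes>\<^bsub>P\<^esub> p \<in> I}"
  have "ideal M P"
    unfolding P.ideal_iff
  proof (intro conjI ballI)
    show "M \<subseteq> carrier P" by (auto simp: M_def)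
    show "\<zero>\<^bsub>P\<^esub> \<in> M" using I by (simp add: M_def)
    show "p \<oplus>\<^bsub>P\<^esub> q \<in> M" if "p \<in> M" "q \<in> M" for p q
      using that I by (simp add: M_def P.r_distr)
    show "r \<otimes>\<^bsub>P\<^esub> p \<in> M" if r: "r \<in> carrier P" and p: "p \<in> M" for r p
    proof -
      have "(X \<otimes>\<^bsub>P\<^esub> h) \<otimes>\<^bsub>P\<^esub> (r \<otimes>\<^bsub>P\<^esub> p) = (X \<otimes>\<^bsub>P\<^esub> (h \<otimes>\<^bsub>P\<^esub> r)) \<otimes>\<^bsub>P\<^esub> p"
        if "h \<in> carrier P" for h
        using that r p by (simp add: M_def P.m_assoc)
      then show ?thesis
        using r p by (simp add: M_def)
    qed
  qed
  then obtain f where f: "f \<in> carrier P" "M = PIdl\<^bsub>P\<^esub> f"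
    using P.exists_gen by blast
  show thesis
  proof (rule that)
    show "f \<in> carrier P" by fact
    have "f \<in> M"
      using f P.cgenideal_self by simp
    then show "(X \<otimes>\<^bsub>P\<^esub> f) \<otimes>\<^bsub>P\<^esub> h \<in> I" if "h \<in> carrier P" for h
      using that f(1) P.m_comm[of f h] by (auto simp: M_def P.m_assoc)
    show "\<exists>g\<in>carrier P. p = f \<otimes>\<^bsub>P\<^esub> g" if p: "p \<in> I" for p
    proof -
      have "p \<in> M"
        using p I I_P by (simp add: M_def)
      then show ?thesis
        using f P.m_comm[OF f(1)] unfolding cgenideal_def by auto
    qed
  qed
qed

text \<open>
  The generators of \<open>I\<close> are \<open>Xf\<close>, witnesses for the layer between \<open>XfP\<close> and \<open>fP\<close>, and witnesses for
  the layer between \<open>X(Xf)P\<close> and \<open>XfP\<close>. The ideal \<open>N\<close> that they generate is shown to reach \<open>I\<close> from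
  below, one layer at a time.
\<close>
lemma noetherian_if_finite_dimension:
  assumes fin: "finite_dimension K (carrier L)"
  shows "noetherian_ring T"
proof (rule T.noetherian_ringI)
  fix I assume I: "ideal I T"
  obtain f where f: "f \<in> carrier P"
    and Xf_I: "\<And>h. h \<in> carrier P \<Longrightarrow> (X \<otimes>\<^bsub>P\<^esub> f) \<otimes>\<^bsub>P\<^esub> h \<in> I"
    and I_f: "\<And>p. p \<in> I \<Longrightarrow> \<exists>g\<in>carrier P. p = f \<otimes>\<^bsub>P\<^esub> g"
    using T_ideal_between[OF I] by blast
  define f' where "f' = X \<otimes>\<^bsub>P\<^esub> f"
  have f': "f' \<in> carrier P" using f by (simp add: f'_def)
  obtain A where A: "finite A" "A \<subseteq> I"
    "\<And>N. ideal N T \<Longrightarrow> A \<subseteq> N \<Longrightarrow> cofactor_consts I f \<subseteq> cofactor_consts N f"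
    using finite_cofactor_witnesses[OF fin I f] by blast
  obtain B where B: "finite B" "B \<subseteq> I"
    "\<And>N. ideal N T \<Longrightarrow> B \<subseteq> N \<Longrightarrow> cofactor_consts I f' \<subseteq> cofactor_consts N f'"
    using finite_cofactor_witnesses[OF fin I f'] by blast
  define C where "C = insert f' (A \<union> B)"
  have "f' \<in> I"
    using Xf_I[of "\<one>\<^bsub>P\<^esub>"] f' by (simp add: f'_def)
  then have C: "finite C" "C \<subseteq> I" "C \<subseteq> carrier T"
    using A B I unfolding C_def T_ideal_iff by auto
  define N where "N = Idl\<^bsub>T\<^esub> C"
  have N: "ideal N T" "C \<subseteq> N" "N \<subseteq> I"
    using T.genideal_ideal[OF C(3)] T.genideal_self[OF C(3)] T.genideal_minimal[OF I C(2)]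
    by (auto simp: N_def)
  \<comment> \<open>The lower layer: \<open>X(Xf)q\<close> is the multiple of the generator \<open>Xf\<close> by \<open>Xq \<in> T\<close>, and \<open>I\<close> contains
     all of \<open>XfP\<close>, so that \<open>N\<close> inherits every cofactor constant of \<open>Xf\<close>.\<close>
  have f'_N: "f' \<otimes>\<^bsub>P\<^esub> h \<in> N" if h: "h \<in> carrier P" for h
  proof (rule mult_mem_if_cofactor_const[OF N(1) f' _ h])
    show "(X \<otimes>\<^bsub>P\<^esub> f') \<otimes>\<^bsub>P\<^esub> q \<in> N" if q: "q \<in> carrier P" for q
    proof -
      have "(X \<otimes>\<^bsub>P\<^esub> f') \<otimes>\<^bsub>P\<^esub> q = (X \<otimes>\<^bsub>P\<^esub> q) \<otimes>\<^bsub>P\<^esub> f'"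
        using q f' var_P by algebra
      then show ?thesis
        using N(1,2) q unfolding T_ideal_iff C_def by simp
    qed
    have "coeff h 0 \<in> cofactor_consts I f'"
      using Xf_I[OF h] h unfolding cofactor_consts_def f'_def by blast
    then show "coeff h 0 \<in> cofactor_consts N f'"
      using B(3)[OF N(1)] N(2) unfolding C_def by blast
  qed
  \<comment> \<open>The upper layer, now that \<open>N\<close> contains \<open>XfP\<close>.\<close>
  have "p \<in> N" if p: "p \<in> I" for p
  proof -
    obtain g where g: "g \<in> carrier P" "p = f \<otimes>\<^bsub>P\<^esub> g"
      using I_f[OF p] by blast
    then have "coeff g 0 \<in> cofactor_consts I f"
      using p unfolding cofactor_consts_def by blast
    then have "coeff g 0 \<in> cofactor_consts N f"
      using A(3)[OF N(1)] N(2) unfolding C_def by blast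
    then show ?thesis
      using mult_mem_if_cofactor_const[OF N(1) f _ g(1)] f'_N g(2) unfolding f'_def by simp
  qed
  then have "I = Idl\<^bsub>T\<^esub> C"
    using N(3) by (auto simp: N_def)
  then show "\<exists>A\<subseteq>carrier T. finite A \<and> I = Idl\<^bsub>T\<^esub> A"
    using C by blast
qed

end

theorem proposition3p2:
  fixes L :: "('a, 'b) ring_scheme" and K :: "'a set"
  assumes "field L" and "subfield K L"
  shows "noetherian_ring (polynomial_composite L K) \<longleftrightarrow> ring.finite_dimension L K (carrier L)"
proof -
  interpret field_composite L K
    using assms by (intro field_composite.intro field_composite_axioms.intro)
  show ?thesis
    using finite_dimension_if_noetherian noetherian_if_finite_dimension by blast
qed

end
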